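(* The assignment $[n] \mapsto \nabla_n$ extends to a (covariant) functor $\nabla : \mathbf{\Delta} \to \mathbf{Top}$, where for a morphism $\sigma : [n] \to [m]$ of $\mathbf{\Delta}$ the map $\nabla(\sigma) : \nabla_n \to \nabla_m$ is $f \mapsto \sigma \circ f$, and the probability-law maps $p_n : \nabla_n \to \Delta_n$, $n \geq 0$, define a natural transformation from the functor $\nabla$ to the functor $\Delta$.
   Context: $(\Omega,\lambda)$ is a fixed atomless complete probability space. $[n] = \{0,\dots,n\}$ for $n \ge 0$, and $\mathbf{\Delta}$ is the category with objects the $[n]$ and morphisms the weakly increasing maps. $\mathbf{Top}$ is a convenient category of topological spaces containing the metrizable ones (for instance weakly Hausdorff compactly generated spaces), with continuous maps. $\nabla_n = L^1(\Omega,[n])$ is the set of measurable maps $f : \Omega \to [n]$ modulo almost everywhere equality, with the topology defined by the metric $d(f,g) = \int_\Omega d(f(t),g(t))\, \mathrm{d}\lambda(t)$, where $[n]$ carries the discrete metric $d(x,y) = 1-\delta_{x,y}$. $\Delta_n = \{(x_0,\dots,x_n) \in [0,1]^{n+1} : \sum_i x_i = 1\}$ with its usual topology; $\Delta : \mathbf{\Delta} \to \mathbf{Top}$ is the functor with $\Delta([n]) = \Delta_n$ and, for $\sigma:[n]\to[m]$, $\Delta(\sigma)(x_0,\dots,x_n) = \big( \sum_{j \in \sigma^{-1}(i)} x_j \big)_{i=0,\dots,m}$. The probability-law map $p_n : \nabla_n \to \Delta_n$ is $f \mapsto (\lambda(f^{-1}(i)))_{i=0,\dots,n}$. *)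

theory Defs
  imports "HOL-Probability.Probability" "HOL-Homology.Simplices"
begin

subsection \<open>Categories, functors, natural transformations\<close>

text \<open>
  Categories are given by hom-sets. As the sets \<open>Mor X Y\<close> need not be disjoint, composition and
  functors take the objects as arguments: for \<open>f \<in> Mor X Y\<close> and \<open>g \<in> Mor Y Z\<close>, the composite
  is \<open>Comp X Y Z g f\<close>.
\<close>

record ('o, 'm) category_data =
  Ob :: "'o set"
  Mor :: "'o \<Rightarrow> 'o \<Rightarrow> 'm set"
  Ident :: "'o \<Rightarrow> 'm"
  Comp :: "'o \<Rightarrow> 'o \<Rightarrow> 'o \<Rightarrow> 'm \<Rightarrow> 'm \<Rightarrow> 'm"

locale category =
  fixes C :: "('o, 'm) category_data"
  assumes Ident_in: "X \<in> Ob C \<Longrightarrow> Ident C X \<in> Mor C X X"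
    and Comp_in: "\<lbrakk>X \<in> Ob C; Y \<in> Ob C; Z \<in> Ob C; f \<in> Mor C X Y; g \<in> Mor C Y Z\<rbrakk>
      \<Longrightarrow> Comp C X Y Z g f \<in> Mor C X Z"
    and Comp_Ident_right: "\<lbrakk>X \<in> Ob C; Y \<in> Ob C; f \<in> Mor C X Y\<rbrakk>
      \<Longrightarrow> Comp C X X Y f (Ident C X) = f"
    and Comp_Ident_left: "\<lbrakk>X \<in> Ob C; Y \<in> Ob C; f \<in> Mor C X Y\<rbrakk>
      \<Longrightarrow> Comp C X Y Y (Ident C Y) f = f"
    and Comp_assoc: "\<lbrakk>W \<in> Ob C; X \<in> Ob C; Y \<in> Ob C; Z \<in> Ob C;
        f \<in> Mor C W X; g \<in> Mor C X Y; h \<in> Mor C Y Z\<rbrakk>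
      \<Longrightarrow> Comp C W Y Z h (Comp C W X Y g f) = Comp C W X Z (Comp C X Y Z h g) f"

locale covariant_functor = A: category A + B: category B
  for A :: "('o, 'm) category_data" and B :: "('p, 'n) category_data" +
  fixes F_ob :: "'o \<Rightarrow> 'p" and F_mor :: "'o \<Rightarrow> 'o \<Rightarrow> 'm \<Rightarrow> 'n"
  assumes F_ob_in: "X \<in> Ob A \<Longrightarrow> F_ob X \<in> Ob B"
    and F_mor_in: "\<lbrakk>X \<in> Ob A; Y \<in> Ob A; f \<in> Mor A X Y\<rbrakk>
      \<Longrightarrow> F_mor X Y f \<in> Mor B (F_ob X) (F_ob Y)"
    and F_Ident: "X \<in> Ob A \<Longrightarrow> F_mor X X (Ident A X) = Ident B (F_ob X)"
    and F_Comp: "\<lbrakk>X \<in> Ob A; Y \<in> Ob A; Z \<in> Ob A; f \<in> Mor A X Y; g \<in> Mor A Y Z\<rbrakk>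
      \<Longrightarrow> F_mor X Z (Comp A X Y Z g f)
        = Comp B (F_ob X) (F_ob Y) (F_ob Z) (F_mor Y Z g) (F_mor X Y f)"

locale natural_transformation =
  F: covariant_functor A B F_ob F_mor + G: covariant_functor A B G_ob G_mor
  for A :: "('o, 'm) category_data" and B :: "('p, 'n) category_data"
    and F_ob F_mor G_ob G_mor +
  fixes \<eta> :: "'o \<Rightarrow> 'n"
  assumes component_in: "X \<in> Ob A \<Longrightarrow> \<eta> X \<in> Mor B (F_ob X) (G_ob X)"
    and naturality: "\<lbrakk>X \<in> Ob A; Y \<in> Ob A; f \<in> Mor A X Y\<rbrakk>
      \<Longrightarrow> Comp B (F_ob X) (F_ob Y) (G_ob Y) (\<eta> Y) (F_mor X Y f)
        = Comp B (F_ob X) (G_ob X) (G_ob Y) (G_mor X Y f) (\<eta> X)"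

text \<open>The object \<open>[n] = {0, \<dots>, n}\<close> is represented by the number \<open>n\<close>.\<close>

definition simplex_category :: "(nat, nat \<Rightarrow> nat) category_data" where
  "simplex_category = \<lparr>
     Ob = UNIV,
     Mor = (\<lambda>n m. {\<sigma> \<in> {..n} \<rightarrow>\<^sub>E {..m}. mono_on {..n} \<sigma>}),
     Ident = (\<lambda>n. \<lambda>i\<in>{..n}. i),
     Comp = (\<lambda>n m k \<tau> \<sigma>. compose {..n} \<tau> \<sigma>)\<rparr>"

text \<open>
  The full subcategory, on a class \<open>\<S>\<close> of topological spaces, of the category of spaces
  with points in \<open>'u\<close> and continuous maps. Maps are normalised to be \<open>undefined\<close> outside the
  domain, so that equality of morphisms is equality of maps.
\<close>

definition top_category :: "'u topology set \<Rightarrow> ('u topology, 'u \<Rightarrow> 'u) category_data" where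
  "top_category \<S> = \<lparr>
     Ob = \<S>,
     Mor = (\<lambda>X Y. {f \<in> extensional (topspace X). continuous_map X Y f}),
     Ident = (\<lambda>X. \<lambda>x\<in>topspace X. x),
     Comp = (\<lambda>X Y Z g f. compose (topspace X) g f)\<rparr>"

definition atomless :: "'a measure \<Rightarrow> bool" where
  "atomless M \<longleftrightarrow> (\<forall>A\<in>sets M. emeasure M A > 0 \<longrightarrow>
     (\<exists>B\<in>sets M. B \<subseteq> A \<and> 0 < emeasure M B \<and> emeasure M B < emeasure M A))"

subsection \<open>The spaces \<open>\<nabla>\<^sub>n\<close>\<close>

abbreviation simplex_maps :: "'a measure \<Rightarrow> nat \<Rightarrow> ('a \<Rightarrow> nat) set" where
  "simplex_maps M n \<equiv> M \<rightarrow>\<^sub>M count_space {..n}"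

definition ae_rel :: "'a measure \<Rightarrow> nat \<Rightarrow> (('a \<Rightarrow> nat) \<times> ('a \<Rightarrow> nat)) set" where
  "ae_rel M n = {(f, g). f \<in> simplex_maps M n \<and> g \<in> simplex_maps M n \<and> (AE t in M. f t = g t)}"

definition ae_class :: "'a measure \<Rightarrow> nat \<Rightarrow> ('a \<Rightarrow> nat) \<Rightarrow> ('a \<Rightarrow> nat) set" where
  "ae_class M n f = ae_rel M n `` {f}"

definition nabla :: "'a measure \<Rightarrow> nat \<Rightarrow> ('a \<Rightarrow> nat) set set" where
  "nabla M n = simplex_maps M n // ae_rel M n"

text \<open>
  In the following, \<open>the_elem\<close> and the union over representatives express that the value does
  not depend on the chosen representatives. Outside \<^term>\<open>nabla M n\<close> the distance
  is set to \<open>0\<close>, since \<^locale>\<open>Metric_space\<close> asks for symmetry and nonnegativity everywhere.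
\<close>

definition nabla_dist ::
    "'a measure \<Rightarrow> nat \<Rightarrow> ('a \<Rightarrow> nat) set \<Rightarrow> ('a \<Rightarrow> nat) set \<Rightarrow> real" where
  "nabla_dist M n F G = (if F \<in> nabla M n \<and> G \<in> nabla M n
     then the_elem ((\<lambda>(f, g). LINT t|M. (if f t = g t then 0 else 1)) ` (F \<times> G)) else 0)"

definition nabla_space :: "'a measure \<Rightarrow> nat \<Rightarrow> ('a \<Rightarrow> nat) set topology" where
  "nabla_space M n = Metric_space.mtopology (nabla M n) (nabla_dist M n)"

definition nabla_map :: "'a measure \<Rightarrow> nat \<Rightarrow> (nat \<Rightarrow> nat) \<Rightarrow> ('a \<Rightarrow> nat) set \<Rightarrow> ('a \<Rightarrow> nat) set" where
  "nabla_map M m \<sigma> F = (\<Union>f\<in>F. ae_class M m (\<sigma> \<circ> f))"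

definition prob_law :: "'a measure \<Rightarrow> ('a \<Rightarrow> nat) set \<Rightarrow> (nat \<Rightarrow> real)" where
  "prob_law M F = the_elem ((\<lambda>f i. measure M (f -` {i} \<inter> space M)) ` F)"

subsection \<open>The standard simplices\<close>

text \<open>Points of \<^const>\<open>standard_simplex\<close> are sequences that vanish beyond index \<open>n\<close>.\<close>

definition simplex_space :: "nat \<Rightarrow> (nat \<Rightarrow> real) topology" where
  "simplex_space n = subtopology (powertop_real UNIV) (standard_simplex n)"

definition simplex_map :: "nat \<Rightarrow> (nat \<Rightarrow> nat) \<Rightarrow> (nat \<Rightarrow> real) \<Rightarrow> (nat \<Rightarrow> real)" where
  "simplex_map n \<sigma> x = (\<lambda>i. \<Sum>j | j \<le> n \<and> \<sigma> j = i. x j)"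

subsection \<open>The functors and the probability-law maps\<close>

text \<open>
  The spaces \<open>\<nabla>\<^sub>n\<close> and \<open>\<Delta>\<^sub>n\<close> have points of different types. To be objects of one
  category, they are copied into the sum of the two types along \<^const>\<open>Inl\<close> and \<^const>\<open>Inr\<close>.
\<close>

type_synonym 'a point = "('a \<Rightarrow> nat) set + (nat \<Rightarrow> real)"

definition copy_space :: "('b \<Rightarrow> 'c) \<Rightarrow> 'b topology \<Rightarrow> 'c topology" where
  "copy_space e X = pullback_topology (e ` topspace X) (inv_into UNIV e) X"

definition copy_map :: "('b \<Rightarrow> 'u) \<Rightarrow> ('c \<Rightarrow> 'u) \<Rightarrow> 'b set \<Rightarrow> ('b \<Rightarrow> 'c) \<Rightarrow> 'u \<Rightarrow> 'u" where
  "copy_map e e' A f = restrict (e' \<circ> f \<circ> inv_into UNIV e) (e ` A)"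

definition Nabla_ob :: "'a measure \<Rightarrow> nat \<Rightarrow> 'a point topology" where
  "Nabla_ob M n = copy_space Inl (nabla_space M n)"

definition Nabla_mor :: "'a measure \<Rightarrow> nat \<Rightarrow> nat \<Rightarrow> (nat \<Rightarrow> nat) \<Rightarrow> 'a point \<Rightarrow> 'a point" where
  "Nabla_mor M n m \<sigma> = copy_map Inl Inl (nabla M n) (nabla_map M m \<sigma>)"

definition Delta_ob :: "nat \<Rightarrow> 'a point topology" where
  "Delta_ob n = copy_space Inr (simplex_space n)"

definition Delta_mor :: "nat \<Rightarrow> nat \<Rightarrow> (nat \<Rightarrow> nat) \<Rightarrow> 'a point \<Rightarrow> 'a point" where
  "Delta_mor n m \<sigma> = copy_map Inr Inr (standard_simplex n) (simplex_map n \<sigma>)"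

definition law_map :: "'a measure \<Rightarrow> nat \<Rightarrow> 'a point \<Rightarrow> 'a point" where
  "law_map M n = copy_map Inl Inr (nabla M n) (prob_law M)"

end

theory Submission
  imports Defs
begin

text \<open>
  Post-composition with \<open>\<sigma>\<close> can only shrink the set of points at which two maps \<open>f\<close> and \<open>g\<close>
  disagree, and the distance in \<open>\<nabla>\<^sub>n\<close> between the classes of \<open>f\<close> and \<open>g\<close> is the measure of this
  set (\<open>nabla_dist_ae_class\<close>). Hence \<open>f \<mapsto> \<sigma> \<circ> f\<close> is well defined on classes and
  1-Lipschitz (\<open>continuous_map_nabla_map\<close>), and functoriality is associativity of
  composition. Likewise the probabilities of \<open>f = i\<close> and \<open>g = i\<close> differ by at most the measure of
  the disagreement set, so each coordinate of the probability law is 1-Lipschitz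
  (\<open>continuous_map_prob_law\<close>). Naturality is additivity of the measure on the decomposition of
  \<open>{\<sigma> \<circ> f = i}\<close> into the sets \<open>{f = j}\<close> with \<open>\<sigma> j = i\<close> (\<open>prob_law_nabla_map\<close>).

  All the spaces are metrizable, \<open>\<Delta>\<^sub>n\<close> because it is a subspace of a countable power of the real
  line. Since objects are copies of these spaces inside a sum type and morphisms are normalised maps
  between the copies, everything is transported along the injections: copying preserves
  metrizability, continuity, identities and composites.
\<close>

section \<open>Copies of spaces and maps\<close>

lemma topspace_copy_space:
  assumes "inj e"
  shows "topspace (copy_space e X) = e ` topspace X"
  using assms by (auto simp: copy_space_def topspace_pullback_topology)

lemma continuous_map_copy_space_inv:
  "continuous_map (copy_space e X) X (inv_into UNIV e)"
  using continuous_map_pullback[OF continuous_map_id, of "e ` topspace X" "inv_into UNIV e" X]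
  by (simp add: copy_space_def)

lemma continuous_map_into_copy_space:
  assumes "inj e"
  shows "continuous_map X (copy_space e X) e"
  unfolding copy_space_def
proof (rule continuous_map_pullback')
  show "continuous_map X X (inv_into UNIV e \<circ> e)"
    using assms by simp
qed auto

lemma metrizable_space_copy_space:
  assumes "inj e" and "metrizable_space X"
  shows "metrizable_space (copy_space e X)"
proof -
  have "homeomorphic_maps X (copy_space e X) e (inv_into UNIV e)"
    using assms(1)
    by (auto simp: homeomorphic_maps_def continuous_map_into_copy_space
        continuous_map_copy_space_inv topspace_copy_space)
  then show ?thesis
    using assms(2) homeomorphic_metrizable_space homeomorphic_space_def by blast
qed

lemma copy_map_apply:
  assumes "inj e" and "x \<in> A"
  shows "copy_map e e' A f (e x) = e' (f x)"
  using assms by (simp add: copy_map_def)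

lemma copy_map_cong:
  assumes "inj e" and "\<And>x. x \<in> A \<Longrightarrow> f x = g x"
  shows "copy_map e e' A f = copy_map e e' A g"
  using assms by (auto simp: copy_map_def fun_eq_iff restrict_def)

lemma copy_map_ident:
  assumes "inj e"
  shows "copy_map e e A (\<lambda>x. x) = (\<lambda>x\<in>e ` A. x)"
  using assms by (auto simp: copy_map_def fun_eq_iff restrict_def)

lemma compose_copy_map:
  assumes "inj e" "inj e'" and "f ` A \<subseteq> B"
  shows "compose (e ` A) (copy_map e' e'' B g) (copy_map e e' A f) = copy_map e e'' A (g \<circ> f)"
  using assms by (auto simp: copy_map_def fun_eq_iff restrict_def compose_def)

lemma copy_map_in_Mor:
  assumes "inj e" "inj e'" and f: "continuous_map X Y f" and "A = topspace X"
  shows "copy_map e e' A f \<in> Mor (top_category \<S>) (copy_space e X) (copy_space e' Y)"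
proof -
  have "continuous_map (copy_space e X) (copy_space e' Y) (e' \<circ> (f \<circ> inv_into UNIV e))"
    using continuous_map_copy_space_inv f continuous_map_into_copy_space[OF assms(2)]
    by (intro continuous_map_compose)
  then have "continuous_map (copy_space e X) (copy_space e' Y) (copy_map e e' A f)"
    by (rule continuous_map_eq)
       (use assms in \<open>auto simp: topspace_copy_space copy_map_def\<close>)
  moreover have "copy_map e e' A f \<in> extensional (topspace (copy_space e X))"
    using assms by (simp add: topspace_copy_space copy_map_def)
  ultimately show ?thesis
    by (simp add: top_category_def)
qed

section \<open>The two categories\<close>

lemma category_simplex_category: "category simplex_category"
proof
  fix X Y Z :: nat and f g
  assume f: "f \<in> Mor simplex_category X Y" and g: "g \<in> Mor simplex_category Y Z"
  have "mono_on {..X} (compose {..X} g f)"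
  proof (rule mono_onI)
    fix i j assume ij: "i \<in> {..X}" "j \<in> {..X}" "i \<le> j"
    with f have "f i \<le> f j" "f i \<in> {..Y}" "f j \<in> {..Y}"
      by (auto simp: simplex_category_def mono_on_def PiE_def Pi_def)
    with g ij show "compose {..X} g f i \<le> compose {..X} g f j"
      by (auto simp: simplex_category_def mono_on_def compose_def)
  qed
  then show "Comp simplex_category X Y Z g f \<in> Mor simplex_category X Z"
    using f g by (auto simp: simplex_category_def PiE_def Pi_def compose_def)
qed (auto simp: simplex_category_def mono_on_def compose_def fun_eq_iff PiE_def Pi_def
    extensional_def)

lemma category_top_category: "category (top_category \<S>)"
proof
  fix X Y Z and f g
  assume f: "f \<in> Mor (top_category \<S>) X Y" and g: "g \<in> Mor (top_category \<S>) Y Z"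
  then have "continuous_map X Z (g \<circ> f)"
    by (auto simp: top_category_def intro: continuous_map_compose)
  then have "continuous_map X Z (compose (topspace X) g f)"
    by (rule continuous_map_eq) (simp add: compose_def)
  then show "Comp (top_category \<S>) X Y Z g f \<in> Mor (top_category \<S>) X Z"
    by (simp add: top_category_def compose_extensional)
next
  fix X :: "'a topology"
  have "continuous_map X X (\<lambda>x\<in>topspace X. x)"
    using continuous_map_id by (rule continuous_map_eq) simp
  then show "Ident (top_category \<S>) X \<in> Mor (top_category \<S>) X X"
    by (simp add: top_category_def)
next
  fix W X Y Z and f g h :: "'a \<Rightarrow> 'a"
  assume "f \<in> Mor (top_category \<S>) W X"
  then have "f \<in> topspace W \<rightarrow> topspace X"
    by (simp add: top_category_def continuous_map_funspace)
  then show "Comp (top_category \<S>) W Y Z h (Comp (top_category \<S>) W X Y g f)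
      = Comp (top_category \<S>) W X Z (Comp (top_category \<S>) X Y Z h g) f"
    by (simp add: top_category_def compose_assoc)
next
  fix X Y and f
  assume "f \<in> Mor (top_category \<S>) X Y"
  then have "f \<in> topspace X \<rightarrow> topspace Y" "f \<in> extensional (topspace X)"
    by (auto simp: top_category_def continuous_map_funspace)
  then show "Comp (top_category \<S>) X X Y f (Ident (top_category \<S>) X) = f"
    and "Comp (top_category \<S>) X Y Y (Ident (top_category \<S>) Y) f = f"
    by (auto simp: top_category_def compose_Id Id_compose)
qed

lemma simplex_category_MorD:
  assumes "\<sigma> \<in> Mor simplex_category n m"
  shows "\<sigma> \<in> {..n} \<rightarrow> {..m}"
  using assms by (auto simp: simplex_category_def)

section \<open>Almost everywhere classes\<close>

lemma simplex_maps_comp: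
  assumes "\<sigma> \<in> {..n} \<rightarrow> {..m}" and "f \<in> simplex_maps M n"
  shows "\<sigma> \<circ> f \<in> simplex_maps M m"
  using assms(2) by (rule measurable_comp) (use assms(1) in simp)

lemma simplex_maps_le:
  assumes "f \<in> simplex_maps M n" and "t \<in> space M"
  shows "f t \<le> n"
  using measurable_space[OF assms] by simp

lemma simplex_maps_vimage_sets:
  assumes "f \<in> simplex_maps M n"
  shows "f -` A \<inter> space M \<in> sets M"
proof -
  \<comment> \<open>Measurability only speaks of subsets of \<open>{..n}\<close>, but \<open>f\<close> has no other values.\<close>
  have "f -` (A \<inter> {..n}) \<inter> space M \<in> sets M"
    using assms by (rule measurable_sets) simp
  also have "f -` (A \<inter> {..n}) \<inter> space M = f -` A \<inter> space M"
    using simplex_maps_le[OF assms] by auto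
  finally show ?thesis .
qed

lemma disagree_sets:
  assumes f: "f \<in> simplex_maps M n" and g: "g \<in> simplex_maps M n"
  shows "{t \<in> space M. f t \<noteq> g t} \<in> sets M"
proof -
  have "{t \<in> space M. f t \<noteq> g t} = (\<Union>i\<le>n. (f -` {i} \<inter> space M) - (g -` {i} \<inter> space M))"
    using simplex_maps_le[OF f] by auto
  then show ?thesis
    using simplex_maps_vimage_sets[OF f] simplex_maps_vimage_sets[OF g] by auto
qed

lemma ae_class_iff:
  "g \<in> ae_class M n f \<longleftrightarrow>
    f \<in> simplex_maps M n \<and> g \<in> simplex_maps M n \<and> (AE t in M. f t = g t)"
  by (auto simp: ae_class_def ae_rel_def)

lemma ae_class_self:
  assumes "f \<in> simplex_maps M n"
  shows "f \<in> ae_class M n f"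
  using assms by (simp add: ae_class_iff)

lemma ae_class_eqI:
  assumes "f \<in> simplex_maps M n" "g \<in> simplex_maps M n" and fg: "AE t in M. f t = g t"
  shows "ae_class M n f = ae_class M n g"
proof -
  have "(AE t in M. f t = h t) \<longleftrightarrow> (AE t in M. g t = h t)" for h
    using fg by (intro eventually_subst) (auto elim: eventually_mono)
  then show ?thesis
    using assms by (auto simp: ae_class_iff)
qed

lemma ae_class_in_nabla:
  assumes "f \<in> simplex_maps M n"
  shows "ae_class M n f \<in> nabla M n"
  using assms by (auto simp: nabla_def ae_class_def quotient_def)

lemma nablaE:
  assumes "F \<in> nabla M n"
  obtains f where "f \<in> simplex_maps M n" "F = ae_class M n f"
  using assms unfolding nabla_def ae_class_def by (elim quotientE)

lemma nabla_map_ae_class: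
  assumes \<sigma>: "\<sigma> \<in> {..n} \<rightarrow> {..m}" and f: "f \<in> simplex_maps M n"
  shows "nabla_map M m \<sigma> (ae_class M n f) = ae_class M m (\<sigma> \<circ> f)"
proof -
  have "ae_class M m (\<sigma> \<circ> g) = ae_class M m (\<sigma> \<circ> f)" if "g \<in> ae_class M n f" for g
  proof (rule ae_class_eqI)
    have "AE t in M. f t = g t"
      using that by (simp add: ae_class_iff)
    then show "AE t in M. (\<sigma> \<circ> g) t = (\<sigma> \<circ> f) t"
      by eventually_elim simp
  qed (use that \<sigma> f simplex_maps_comp in \<open>auto simp only: ae_class_iff\<close>)
  then show ?thesis
    using ae_class_self[OF f] unfolding nabla_map_def by blast
qed

lemma nabla_map_in_nabla:
  assumes "\<sigma> \<in> {..n} \<rightarrow> {..m}" and "F \<in> nabla M n"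
  shows "nabla_map M m \<sigma> F \<in> nabla M m"
  using assms(2)
  by (rule nablaE) (simp add: nabla_map_ae_class[OF assms(1)] ae_class_in_nabla
      simplex_maps_comp[OF assms(1)])

lemma nabla_map_ident:
  assumes "F \<in> nabla M n"
  shows "nabla_map M n (\<lambda>i\<in>{..n}. i) F = F"
  using assms
proof (rule nablaE)
  fix f assume f: "f \<in> simplex_maps M n" and F: "F = ae_class M n f"
  have \<sigma>: "(\<lambda>i\<in>{..n}. i) \<in> {..n} \<rightarrow> {..n}"
    by auto
  have "ae_class M n ((\<lambda>i\<in>{..n}. i) \<circ> f) = ae_class M n f"
    using simplex_maps_le[OF f] simplex_maps_comp[OF \<sigma> f] f
    by (intro ae_class_eqI AE_I2) auto
  then show ?thesis
    using nabla_map_ae_class[OF \<sigma> f] F by simp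
qed

lemma nabla_map_compose:
  assumes \<sigma>: "\<sigma> \<in> {..n} \<rightarrow> {..m}" and \<tau>: "\<tau> \<in> {..m} \<rightarrow> {..k}" and "F \<in> nabla M n"
  shows "nabla_map M k (compose {..n} \<tau> \<sigma>) F = nabla_map M k \<tau> (nabla_map M m \<sigma> F)"
  using assms(3)
proof (rule nablaE)
  fix f assume f: "f \<in> simplex_maps M n" and F: "F = ae_class M n f"
  have \<tau>\<sigma>: "compose {..n} \<tau> \<sigma> \<in> {..n} \<rightarrow> {..k}"
    using \<sigma> \<tau> by (rule funcset_compose)
  have "ae_class M k (compose {..n} \<tau> \<sigma> \<circ> f) = ae_class M k (\<tau> \<circ> (\<sigma> \<circ> f))"
    using simplex_maps_comp[OF \<tau>\<sigma> f] simplex_maps_comp[OF \<tau> simplex_maps_comp[OF \<sigma> f]]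
      simplex_maps_le[OF f]
    by (intro ae_class_eqI AE_I2) (auto simp: compose_def)
  then show ?thesis
    using F nabla_map_ae_class[OF \<tau>\<sigma> f] nabla_map_ae_class[OF \<sigma> f]
      nabla_map_ae_class[OF \<tau> simplex_maps_comp[OF \<sigma> f]] by simp
qed

section \<open>The metric\<close>

lemma (in prob_space) nabla_dist_ae_class:
  assumes f: "f \<in> simplex_maps M n" and g: "g \<in> simplex_maps M n"
  shows "nabla_dist M n (ae_class M n f) (ae_class M n g) = prob {t \<in> space M. f t \<noteq> g t}"
proof -
  have "(LINT t|M. (if f' t = g' t then 0 else 1)) = prob {t \<in> space M. f t \<noteq> g t}"
    if f': "f' \<in> ae_class M n f" and g': "g' \<in> ae_class M n g" for f' g'
  proof -
    have m: "f' \<in> simplex_maps M n" "g' \<in> simplex_maps M n"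
      and ae: "AE t in M. f t = f' t" "AE t in M. g t = g' t"
      using f' g' by (simp_all add: ae_class_iff)
    have "(LINT t|M. (if f' t = g' t then 0 else 1 :: real))
        = (LINT t|M. indicator {t \<in> space M. f' t \<noteq> g' t} t)"
      by (rule Bochner_Integration.integral_cong) (auto simp: indicator_def)
    also have "\<dots> = prob {t \<in> space M. f' t \<noteq> g' t}"
      using disagree_sets[OF m] by (simp add: Int_absorb2)
    also have "\<dots> = prob {t \<in> space M. f t \<noteq> g t}"
    proof (rule finite_measure_eq_AE)
      show "AE t in M. t \<in> {t \<in> space M. f' t \<noteq> g' t} \<longleftrightarrow> t \<in> {t \<in> space M. f t \<noteq> g t}"
        using ae by eventually_elim simp
    qed (use disagree_sets m f g in auto)
    finally show ?thesis .
  qed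
  then have "the_elem ((\<lambda>(f, g). LINT t|M. (if f t = g t then 0 else 1))
      ` (ae_class M n f \<times> ae_class M n g)) = prob {t \<in> space M. f t \<noteq> g t}"
    using ae_class_self[OF f] ae_class_self[OF g] by (intro the_elem_image_unique) auto
  then show ?thesis
    using ae_class_in_nabla[OF f] ae_class_in_nabla[OF g] by (simp add: nabla_dist_def)
qed

lemma (in prob_space) Metric_space_nabla: "Metric_space (nabla M n) (nabla_dist M n)"
proof
  fix F G H
  show "0 \<le> nabla_dist M n F G"
  proof (cases "F \<in> nabla M n \<and> G \<in> nabla M n")
    case True
    then show ?thesis
      by (auto elim!: nablaE simp: nabla_dist_ae_class)
  qed (auto simp: nabla_dist_def)
  show "nabla_dist M n F G = nabla_dist M n G F"
  proof (cases "F \<in> nabla M n \<and> G \<in> nabla M n")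
    case True
    then show ?thesis
      by (auto elim!: nablaE simp: nabla_dist_ae_class eq_commute)
  qed (auto simp: nabla_dist_def)
  assume F: "F \<in> nabla M n" and G: "G \<in> nabla M n"
  from F obtain f where f: "f \<in> simplex_maps M n" "F = ae_class M n f" by (rule nablaE)
  from G obtain g where g: "g \<in> simplex_maps M n" "G = ae_class M n g" by (rule nablaE)
  show "nabla_dist M n F G = 0 \<longleftrightarrow> F = G"
  proof
    assume "nabla_dist M n F G = 0"
    then have "prob {t \<in> space M. f t \<noteq> g t} = 0"
      using f g by (simp add: nabla_dist_ae_class)
    then have "AE t in M. f t = g t"
      using disagree_sets[OF f(1) g(1)] by (intro AE_I) (auto simp: emeasure_eq_measure)
    then show "F = G"
      using f g ae_class_eqI by blast
  next
    assume "F = G"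
    then show "nabla_dist M n F G = 0"
      using nabla_dist_ae_class[OF f(1) f(1)] f(2) by simp
  qed
  assume H: "H \<in> nabla M n"
  from H obtain h where h: "h \<in> simplex_maps M n" "H = ae_class M n h" by (rule nablaE)
  have "prob {t \<in> space M. f t \<noteq> h t}
      \<le> prob ({t \<in> space M. f t \<noteq> g t} \<union> {t \<in> space M. g t \<noteq> h t})"
    using disagree_sets[OF f(1) g(1)] disagree_sets[OF g(1) h(1)]
    by (intro finite_measure_mono) auto
  also have "\<dots> \<le> prob {t \<in> space M. f t \<noteq> g t} + prob {t \<in> space M. g t \<noteq> h t}"
    using disagree_sets[OF f(1) g(1)] disagree_sets[OF g(1) h(1)] by (rule measure_Un_le)
  finally show "nabla_dist M n F H \<le> nabla_dist M n F G + nabla_dist M n G H"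
    using f g h by (simp add: nabla_dist_ae_class)
qed

lemma (in prob_space) topspace_nabla_space: "topspace (nabla_space M n) = nabla M n"
  using Metric_space.topspace_mtopology[OF Metric_space_nabla] by (simp add: nabla_space_def)

lemma (in prob_space) metrizable_space_nabla_space: "metrizable_space (nabla_space M n)"
  using Metric_space.metrizable_space_mtopology[OF Metric_space_nabla]
  by (simp add: nabla_space_def)

lemma continuous_map_mtopology_nonexpansive:
  assumes "Metric_space M d" "Metric_space M' d'" and "f ` M \<subseteq> M'"
    and le: "\<And>x y. \<lbrakk>x \<in> M; y \<in> M\<rbrakk> \<Longrightarrow> d' (f x) (f y) \<le> d x y"
  shows "continuous_map (Metric_space.mtopology M d) (Metric_space.mtopology M' d') f"
  unfolding Metric_space.metric_continuous_map[OF assms(1,2)]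
  using assms(3) le by (meson le_less_trans)

lemma (in prob_space) continuous_map_nabla_map:
  assumes \<sigma>: "\<sigma> \<in> {..n} \<rightarrow> {..m}"
  shows "continuous_map (nabla_space M n) (nabla_space M m) (nabla_map M m \<sigma>)"
  unfolding nabla_space_def
proof (rule continuous_map_mtopology_nonexpansive[OF Metric_space_nabla Metric_space_nabla])
  show "nabla_map M m \<sigma> ` nabla M n \<subseteq> nabla M m"
    using nabla_map_in_nabla[OF \<sigma>] by auto
  fix F G assume F: "F \<in> nabla M n" and G: "G \<in> nabla M n"
  from F obtain f where f: "f \<in> simplex_maps M n" "F = ae_class M n f" by (rule nablaE)
  from G obtain g where g: "g \<in> simplex_maps M n" "G = ae_class M n g" by (rule nablaE)
  have "prob {t \<in> space M. (\<sigma> \<circ> f) t \<noteq> (\<sigma> \<circ> g) t} \<le> prob {t \<in> space M. f t \<noteq> g t}"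
    using disagree_sets[OF f(1) g(1)] by (intro finite_measure_mono) auto
  then show "nabla_dist M m (nabla_map M m \<sigma> F) (nabla_map M m \<sigma> G) \<le> nabla_dist M n F G"
    unfolding f(2) g(2) nabla_map_ae_class[OF \<sigma> f(1)] nabla_map_ae_class[OF \<sigma> g(1)]
      nabla_dist_ae_class[OF f(1) g(1)]
      nabla_dist_ae_class[OF simplex_maps_comp[OF \<sigma> f(1)] simplex_maps_comp[OF \<sigma> g(1)]] .
qed

section \<open>The standard simplices\<close>

lemma topspace_simplex_space: "topspace (simplex_space n) = standard_simplex n"
  by (simp add: simplex_space_def)

lemma metrizable_space_simplex_space: "metrizable_space (simplex_space n)"
  unfolding simplex_space_def euclidean_product_topology
  by (intro metrizable_space_subtopology metrizable_space_euclidean)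

lemma simplex_map_in_standard_simplex:
  assumes \<sigma>: "\<sigma> \<in> {..n} \<rightarrow> {..m}" and x: "x \<in> standard_simplex n"
  shows "simplex_map n \<sigma> x \<in> standard_simplex m"
proof -
  have x0: "0 \<le> x j" for j
    using x by (simp add: standard_simplex_def)
  have x1: "(\<Sum>j\<le>n. x j) = 1"
    using x by (simp add: standard_simplex_def)
  have "(\<Sum>i\<le>m. simplex_map n \<sigma> x i) = (\<Sum>i\<le>m. \<Sum>j | j \<in> {..n} \<and> \<sigma> j = i. x j)"
    by (simp add: simplex_map_def)
  also have "\<dots> = (\<Sum>j\<le>n. x j)"
    using \<sigma> by (intro sum.group) auto
  finally have "(\<Sum>i\<le>m. simplex_map n \<sigma> x i) = 1"
    using x1 by simp
  moreover have "simplex_map n \<sigma> x i \<le> 1" for i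
    unfolding simplex_map_def x1[symmetric] by (intro sum_mono2) (auto simp: x0)
  moreover have "simplex_map n \<sigma> x i = 0" if "i > m" for i
  proof -
    have "{j. j \<le> n \<and> \<sigma> j = i} = {}"
      using funcset_mem[OF \<sigma>] that by (auto simp: not_le[symmetric])
    then show ?thesis
      unfolding simplex_map_def by (simp only: sum.empty)
  qed
  ultimately show ?thesis
    by (auto simp: standard_simplex_def simplex_map_def x0 sum_nonneg)
qed

lemma continuous_map_simplex_map:
  assumes "\<sigma> \<in> {..n} \<rightarrow> {..m}"
  shows "continuous_map (simplex_space n) (simplex_space m) (simplex_map n \<sigma>)"
proof -
  have "continuous_map (simplex_space n) (powertop_real UNIV) (simplex_map n \<sigma>)"
    unfolding continuous_map_componentwise_UNIV simplex_map_def simplex_space_def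
    by (intro allI continuous_map_sum continuous_map_from_subtopology
        continuous_map_product_projection) auto
  then show ?thesis
    using simplex_map_in_standard_simplex[OF assms]
    by (auto simp: simplex_space_def[of m] continuous_map_in_subtopology topspace_simplex_space)
qed

lemma simplex_map_ident:
  assumes "x \<in> standard_simplex n"
  shows "simplex_map n (\<lambda>i\<in>{..n}. i) x = x"
proof
  fix i
  have "{j. j \<le> n \<and> (\<lambda>i\<in>{..n}. i) j = i} = (if i \<le> n then {i} else {})"
    by auto
  \<comment> \<open>For \<open>i > n\<close> the sum is empty, and \<open>x i = 0\<close>.\<close>
  then show "simplex_map n (\<lambda>i\<in>{..n}. i) x i = x i"
    using assms by (simp add: simplex_map_def standard_simplex_def)
qed

lemma simplex_map_compose:
  assumes "\<sigma> \<in> {..n} \<rightarrow> {..m}"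
  shows "simplex_map n (compose {..n} \<tau> \<sigma>) x = simplex_map m \<tau> (simplex_map n \<sigma> x)"
proof
  fix k
  have "simplex_map m \<tau> (simplex_map n \<sigma> x) k
      = (\<Sum>i\<in>{i. i \<le> m \<and> \<tau> i = k}. \<Sum>j\<in>{j \<in> {j. j \<le> n \<and> \<tau> (\<sigma> j) = k}. \<sigma> j = i}. x j)"
    unfolding simplex_map_def by (intro sum.cong) auto
  also have "\<dots> = (\<Sum>j | j \<le> n \<and> \<tau> (\<sigma> j) = k. x j)"
    using assms by (intro sum.group) auto
  also have "\<dots> = simplex_map n (compose {..n} \<tau> \<sigma>) x k"
    unfolding simplex_map_def by (intro sum.cong) (auto simp: compose_def)
  finally show "simplex_map n (compose {..n} \<tau> \<sigma>) x k
      = simplex_map m \<tau> (simplex_map n \<sigma> x) k" ..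
qed

section \<open>Probability laws\<close>

lemma (in prob_space) prob_law_ae_class:
  assumes f: "f \<in> simplex_maps M n"
  shows "prob_law M (ae_class M n f) = (\<lambda>i. prob (f -` {i} \<inter> space M))"
  unfolding prob_law_def
proof (rule the_elem_image_unique)
  show "ae_class M n f \<noteq> {}"
    using ae_class_self[OF f] by auto
  fix g assume "g \<in> ae_class M n f"
  then have g: "g \<in> simplex_maps M n" and ae: "AE t in M. f t = g t"
    by (auto simp: ae_class_iff)
  show "(\<lambda>i. prob (g -` {i} \<inter> space M)) = (\<lambda>i. prob (f -` {i} \<inter> space M))"
  proof
    fix i
    show "prob (g -` {i} \<inter> space M) = prob (f -` {i} \<inter> space M)"
    proof (rule finite_measure_eq_AE)
      show "AE t in M. t \<in> g -` {i} \<inter> space M \<longleftrightarrow> t \<in> f -` {i} \<inter> space M"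
        using ae by eventually_elim simp
    qed (use simplex_maps_vimage_sets f g in auto)
  qed
qed

lemma (in prob_space) prob_vimage_eq_sum:
  assumes f: "f \<in> simplex_maps M n" and "finite J"
  shows "prob (f -` J \<inter> space M) = (\<Sum>j\<in>J. prob (f -` {j} \<inter> space M))"
proof -
  have "f -` J \<inter> space M = (\<Union>j\<in>J. f -` {j} \<inter> space M)"
    by auto
  then show ?thesis
    using finite_measure_finite_Union[of J "\<lambda>j. f -` {j} \<inter> space M"] assms(2)
      simplex_maps_vimage_sets[OF f]
    by (auto simp: disjoint_family_on_def)
qed

lemma (in prob_space) prob_law_in_standard_simplex:
  assumes "F \<in> nabla M n"
  shows "prob_law M F \<in> standard_simplex n"
  using assms
proof (rule nablaE)
  fix f assume f: "f \<in> simplex_maps M n" and F: "F = ae_class M n f"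
  have empty: "f -` {i} \<inter> space M = {}" if "i > n" for i
    using simplex_maps_le[OF f] that by fastforce
  have "f -` {..n} \<inter> space M = space M"
    using simplex_maps_le[OF f] by auto
  then have "(\<Sum>i\<le>n. prob (f -` {i} \<inter> space M)) = 1"
    using prob_vimage_eq_sum[OF f, of "{..n}"] prob_space by simp
  then show ?thesis
    by (simp add: F prob_law_ae_class[OF f] standard_simplex_def empty)
qed

lemma (in prob_space) continuous_map_prob_law:
  "continuous_map (nabla_space M n) (simplex_space n) (prob_law M)"
proof -
  have "continuous_map (nabla_space M n) euclideanreal (\<lambda>F. prob_law M F i)" for i
    unfolding nabla_space_def mtopology_is_euclidean[symmetric]
  proof (rule continuous_map_mtopology_nonexpansive[OF Metric_space_nabla Met_TC.Metric_space_axioms])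
    fix F G assume F: "F \<in> nabla M n" and G: "G \<in> nabla M n"
    have one_sided: "prob (f -` {i} \<inter> space M)
        \<le> prob (g -` {i} \<inter> space M) + prob {t \<in> space M. f t \<noteq> g t}"
      if f: "f \<in> simplex_maps M n" and g: "g \<in> simplex_maps M n" for f g
    proof -
      have "prob (f -` {i} \<inter> space M)
          \<le> prob ((g -` {i} \<inter> space M) \<union> {t \<in> space M. f t \<noteq> g t})"
        using simplex_maps_vimage_sets[OF g] disagree_sets[OF f g]
        by (intro finite_measure_mono) auto
      also have "\<dots> \<le> prob (g -` {i} \<inter> space M) + prob {t \<in> space M. f t \<noteq> g t}"
        using simplex_maps_vimage_sets[OF g] disagree_sets[OF f g]
        by (rule measure_Un_le)
      finally show ?thesis .
    qed
    from F obtain f where f: "f \<in> simplex_maps M n" "F = ae_class M n f" by (rule nablaE)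
    from G obtain g where g: "g \<in> simplex_maps M n" "G = ae_class M n g" by (rule nablaE)
    have "{t \<in> space M. g t \<noteq> f t} = {t \<in> space M. f t \<noteq> g t}"
      by auto
    then show "dist (prob_law M F i) (prob_law M G i) \<le> nabla_dist M n F G"
      using one_sided[OF f(1) g(1)] one_sided[OF g(1) f(1)] f g
      by (simp add: nabla_dist_ae_class prob_law_ae_class dist_real_def)
  qed simp
  then show ?thesis
    using prob_law_in_standard_simplex
    by (auto simp: simplex_space_def continuous_map_in_subtopology
        continuous_map_componentwise_UNIV topspace_nabla_space)
qed

lemma (in prob_space) prob_law_nabla_map:
  assumes \<sigma>: "\<sigma> \<in> {..n} \<rightarrow> {..m}" and "F \<in> nabla M n"
  shows "prob_law M (nabla_map M m \<sigma> F) = simplex_map n \<sigma> (prob_law M F)"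
  using assms(2)
proof (rule nablaE)
  fix f assume f: "f \<in> simplex_maps M n" and F: "F = ae_class M n f"
  have "prob ((\<sigma> \<circ> f) -` {i} \<inter> space M) = (\<Sum>j | j \<le> n \<and> \<sigma> j = i. prob (f -` {j} \<inter> space M))" for i
  proof -
    have "(\<sigma> \<circ> f) -` {i} \<inter> space M = f -` {j. j \<le> n \<and> \<sigma> j = i} \<inter> space M"
      using simplex_maps_le[OF f] by auto
    then show ?thesis
      using prob_vimage_eq_sum[OF f, of "{j. j \<le> n \<and> \<sigma> j = i}"] by simp
  qed
  then show ?thesis
    by (simp add: F simplex_map_def nabla_map_ae_class[OF \<sigma> f] prob_law_ae_class[OF f]
        prob_law_ae_class[OF simplex_maps_comp[OF \<sigma> f]])
qed

section \<open>The functors and the natural transformation\<close>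

lemma (in prob_space) covariant_functor_Nabla:
  assumes "\<And>n. Nabla_ob M n \<in> \<S>"
  shows "covariant_functor simplex_category (top_category \<S>) (Nabla_ob M) (Nabla_mor M)"
proof (intro covariant_functor.intro covariant_functor_axioms.intro
    category_simplex_category category_top_category)
  have ob: "topspace (Nabla_ob M n) = Inl ` nabla M n" for n
    by (simp add: Nabla_ob_def topspace_copy_space topspace_nabla_space)
  fix n m k \<sigma> \<tau>
  show "Nabla_ob M n \<in> Ob (top_category \<S>)"
    using assms by (simp add: top_category_def)
  have "copy_map Inl Inl (nabla M n) (nabla_map M n (\<lambda>i\<in>{..n}. i))
      = copy_map Inl Inl (nabla M n) (\<lambda>F. F)"
    by (rule copy_map_cong) (simp_all add: nabla_map_ident)
  then show "Nabla_mor M n n (Ident simplex_category n) = Ident (top_category \<S>) (Nabla_ob M n)"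
    by (simp add: Nabla_mor_def simplex_category_def top_category_def ob copy_map_ident)
  assume "\<sigma> \<in> Mor simplex_category n m"
  then have \<sigma>: "\<sigma> \<in> {..n} \<rightarrow> {..m}"
    by (rule simplex_category_MorD)
  show "Nabla_mor M n m \<sigma> \<in> Mor (top_category \<S>) (Nabla_ob M n) (Nabla_ob M m)"
    unfolding Nabla_mor_def Nabla_ob_def
    by (intro copy_map_in_Mor continuous_map_nabla_map \<sigma>) (simp_all add: topspace_nabla_space)
  assume "\<tau> \<in> Mor simplex_category m k"
  then have \<tau>: "\<tau> \<in> {..m} \<rightarrow> {..k}"
    by (rule simplex_category_MorD)
  have "copy_map Inl Inl (nabla M n) (nabla_map M k (compose {..n} \<tau> \<sigma>))
      = copy_map Inl Inl (nabla M n) (nabla_map M k \<tau> \<circ> nabla_map M m \<sigma>)"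
    by (rule copy_map_cong) (simp_all add: nabla_map_compose[OF \<sigma> \<tau>])
  also have "\<dots> = compose (Inl ` nabla M n) (Nabla_mor M m k \<tau>) (Nabla_mor M n m \<sigma>)"
    unfolding Nabla_mor_def
    by (rule compose_copy_map[symmetric]) (use nabla_map_in_nabla[OF \<sigma>] in auto)
  finally show "Nabla_mor M n k (Comp simplex_category n m k \<tau> \<sigma>)
      = Comp (top_category \<S>) (Nabla_ob M n) (Nabla_ob M m) (Nabla_ob M k)
          (Nabla_mor M m k \<tau>) (Nabla_mor M n m \<sigma>)"
    by (simp add: Nabla_mor_def[of M n k] simplex_category_def top_category_def ob)
qed

lemma covariant_functor_Delta:
  fixes \<S> :: "'a point topology set"
  assumes "\<And>n. Delta_ob n \<in> \<S>"
  shows "covariant_functor simplex_category (top_category \<S>) Delta_ob Delta_mor"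
proof (intro covariant_functor.intro covariant_functor_axioms.intro
    category_simplex_category category_top_category)
  have ob: "topspace (Delta_ob n :: 'a point topology) = Inr ` standard_simplex n" for n
    by (simp add: Delta_ob_def topspace_copy_space topspace_simplex_space)
  fix n m k \<sigma> \<tau>
  show "Delta_ob n \<in> Ob (top_category \<S>)"
    using assms by (simp add: top_category_def)
  have "(copy_map Inr Inr (standard_simplex n) (simplex_map n (\<lambda>i\<in>{..n}. i)) :: 'a point \<Rightarrow> 'a point)
      = copy_map Inr Inr (standard_simplex n) (\<lambda>x. x)"
    by (rule copy_map_cong) (simp_all add: simplex_map_ident)
  then show "Delta_mor n n (Ident simplex_category n) = Ident (top_category \<S>) (Delta_ob n)"
    by (simp add: Delta_mor_def simplex_category_def top_category_def ob copy_map_ident)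
  assume "\<sigma> \<in> Mor simplex_category n m"
  then have \<sigma>: "\<sigma> \<in> {..n} \<rightarrow> {..m}"
    by (rule simplex_category_MorD)
  show "Delta_mor n m \<sigma> \<in> Mor (top_category \<S>) (Delta_ob n) (Delta_ob m)"
    unfolding Delta_mor_def Delta_ob_def
    by (intro copy_map_in_Mor continuous_map_simplex_map \<sigma>) (simp_all add: topspace_simplex_space)
  have "(copy_map Inr Inr (standard_simplex n) (simplex_map n (compose {..n} \<tau> \<sigma>))
        :: 'a point \<Rightarrow> 'a point)
      = copy_map Inr Inr (standard_simplex n) (simplex_map m \<tau> \<circ> simplex_map n \<sigma>)"
    by (rule copy_map_cong) (simp_all add: simplex_map_compose[OF \<sigma>])
  also have "\<dots> = compose (Inr ` standard_simplex n) (Delta_mor m k \<tau>) (Delta_mor n m \<sigma>)"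
    unfolding Delta_mor_def
    by (rule compose_copy_map[symmetric]) (use simplex_map_in_standard_simplex[OF \<sigma>] in auto)
  finally show "Delta_mor n k (Comp simplex_category n m k \<tau> \<sigma>)
      = Comp (top_category \<S>) (Delta_ob n) (Delta_ob m) (Delta_ob k)
          (Delta_mor m k \<tau>) (Delta_mor n m \<sigma>)"
    by (simp add: Delta_mor_def[of n k] simplex_category_def top_category_def ob)
qed

lemma (in prob_space) natural_transformation_law_map:
  assumes "\<And>n. Nabla_ob M n \<in> \<S>" and "\<And>n. Delta_ob n \<in> \<S>"
  shows "natural_transformation simplex_category (top_category \<S>)
    (Nabla_ob M) (Nabla_mor M) Delta_ob Delta_mor (law_map M)"
proof (intro natural_transformation.intro natural_transformation_axioms.intro
    covariant_functor_Nabla covariant_functor_Delta assms)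
  fix n m \<sigma>
  show "law_map M n \<in> Mor (top_category \<S>) (Nabla_ob M n) (Delta_ob n)"
    unfolding law_map_def Nabla_ob_def Delta_ob_def
    by (intro copy_map_in_Mor continuous_map_prob_law) (simp_all add: topspace_nabla_space)
  assume "\<sigma> \<in> Mor simplex_category n m"
  then have \<sigma>: "\<sigma> \<in> {..n} \<rightarrow> {..m}"
    by (rule simplex_category_MorD)
  have "compose (Inl ` nabla M n) (law_map M m) (Nabla_mor M n m \<sigma>)
      = copy_map Inl Inr (nabla M n) (prob_law M \<circ> nabla_map M m \<sigma>)"
    unfolding law_map_def Nabla_mor_def
    by (rule compose_copy_map) (use nabla_map_in_nabla[OF \<sigma>] in auto)
  also have "\<dots> = copy_map Inl Inr (nabla M n) (simplex_map n \<sigma> \<circ> prob_law M)"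
    by (rule copy_map_cong) (simp_all add: prob_law_nabla_map[OF \<sigma>])
  also have "\<dots> = compose (Inl ` nabla M n) (Delta_mor n m \<sigma>) (law_map M n)"
    unfolding law_map_def Delta_mor_def
    by (rule compose_copy_map[symmetric]) (use prob_law_in_standard_simplex in auto)
  finally show "Comp (top_category \<S>) (Nabla_ob M n) (Nabla_ob M m) (Delta_ob m)
        (law_map M m) (Nabla_mor M n m \<sigma>)
      = Comp (top_category \<S>) (Nabla_ob M n) (Delta_ob n) (Delta_ob m)
        (Delta_mor n m \<sigma>) (law_map M n)"
    by (simp add: top_category_def Nabla_ob_def topspace_copy_space topspace_nabla_space)
qed

theorem proposition1p1:
  fixes \<Omega> :: "'a measure" and \<S> :: "'a point topology set"
  assumes "prob_space \<Omega>" and "complete_measure \<Omega>" and "atomless \<Omega>"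
    and metrizable_in: "\<And>X. metrizable_space X \<Longrightarrow> X \<in> \<S>"
  shows "covariant_functor simplex_category (top_category \<S>) (Nabla_ob \<Omega>) (Nabla_mor \<Omega>)
    \<and> (\<forall>n m \<sigma> f. \<sigma> \<in> Mor simplex_category n m \<and> f \<in> simplex_maps \<Omega> n \<longrightarrow>
          \<sigma> \<circ> f \<in> simplex_maps \<Omega> m
        \<and> Nabla_mor \<Omega> n m \<sigma> (Inl (ae_class \<Omega> n f)) = Inl (ae_class \<Omega> m (\<sigma> \<circ> f)))
    \<and> (\<forall>n f. f \<in> simplex_maps \<Omega> n \<longrightarrow>
          law_map \<Omega> n (Inl (ae_class \<Omega> n f)) = Inr (\<lambda>i. measure \<Omega> (f -` {i} \<inter> space \<Omega>)))
    \<and> natural_transformation simplex_category (top_category \<S>)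
          (Nabla_ob \<Omega>) (Nabla_mor \<Omega>) Delta_ob Delta_mor (law_map \<Omega>)"
proof -
  interpret prob_space \<Omega> by fact
  have Nabla_in: "Nabla_ob \<Omega> n \<in> \<S>" for n
    unfolding Nabla_ob_def
    by (intro metrizable_in metrizable_space_copy_space metrizable_space_nabla_space) simp
  have Delta_in: "Delta_ob n \<in> \<S>" for n
    unfolding Delta_ob_def
    by (intro metrizable_in metrizable_space_copy_space metrizable_space_simplex_space) simp
  have "\<sigma> \<circ> f \<in> simplex_maps \<Omega> m
      \<and> Nabla_mor \<Omega> n m \<sigma> (Inl (ae_class \<Omega> n f)) = Inl (ae_class \<Omega> m (\<sigma> \<circ> f))"
    if "\<sigma> \<in> Mor simplex_category n m" and f: "f \<in> simplex_maps \<Omega> n" for n m \<sigma> f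
    using simplex_maps_comp[OF simplex_category_MorD[OF that(1)] f]
      nabla_map_ae_class[OF simplex_category_MorD[OF that(1)] f] ae_class_in_nabla[OF f]
    by (simp add: Nabla_mor_def copy_map_apply)
  moreover have "law_map \<Omega> n (Inl (ae_class \<Omega> n f)) = Inr (\<lambda>i. measure \<Omega> (f -` {i} \<inter> space \<Omega>))"
    if f: "f \<in> simplex_maps \<Omega> n" for n f
    using prob_law_ae_class[OF f] ae_class_in_nabla[OF f]
    by (simp add: law_map_def copy_map_apply)
  ultimately show ?thesis
    using covariant_functor_Nabla[OF Nabla_in] natural_transformation_law_map[OF Nabla_in Delta_in]
    by blast
qed

end
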